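(* Let $Z_1,\dots,Z_n\sim F$ and $Z_{n+1}\sim G$ be independent, where $Z_i=(X_i,Y_i)$, and let $w^*=\mathrm{d}G/\mathrm{d}F$. Fix $\alpha\in[0,1]$ and a weight function $w:\mathcal{X}\times\mathcal{Y}\to(0,\infty)$. Then the unnormalized weighted conformal prediction set $$\mathcal{C}(X_{n+1})=\Bigg\{y\in\mathcal{Y}: S^y_{n+1}\le\inf\bigg\{s\in\mathbb{R}:\frac{\sum_{i=1}^{n+1}w(Z^y_i)\,\mathbf{1}\{S^y_i>s\}}{n+1}\le\alpha\bigg\}\Bigg\}$$ satisfies the following. (a) If $w=w^*$, then $\mathbb{P}\{Y_{n+1}\in\mathcal{C}(X_{n+1})\}\ge1-\alpha$. (b) For any $w$, $\mathbb{P}\{Y_{n+1}\in\mathcal{C}(X_{n+1})\}\ge1-\alpha-\mathbb{E}_F\big[(w^*(X,Y)-w(X,Y))_+\big]$.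
   Context: $\mathcal{X},\mathcal{Y}$ are measurable spaces, $\mathcal{Z}=\mathcal{X}\times\mathcal{Y}$, $n\ge1$, and all functions are measurable. $F,G$ are distributions on $\mathcal{Z}$ such that the density (likelihood ratio) $w^*=\mathrm{d}G/\mathrm{d}F$ exists. $\mathbb{E}_F$ is the expectation over $(X,Y)\sim F$, and $(t)_+=\max\{t,0\}$. A score function $\mathsf{s}((x,y),\mathrm{bag}(z))\in\mathbb{R}$ is fixed; it assigns a real value to a point $(x,y)\in\mathcal{Z}$ given the unordered multiset $\mathrm{bag}(z)$ of the entries of a dataset $z\in\mathcal{Z}^{n+1}$ (so it is invariant to permutations of $z$). For $y\in\mathcal{Y}$, let $Z^y=(Z_1,\dots,Z_n,(X_{n+1},y))$ with $i$th entry $Z^y_i$, and $S^y_i=\mathsf{s}(Z^y_i,\mathrm{bag}(Z^y))$, $i=1,\dots,n+1$. The infimum may equal $-\infty$. *)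

theory Defs
  imports "HOL-Probability.Probability" "HOL-Library.Multiset"
begin

text \<open>Datasets \<open>z\<close> are functions on \<open>nat\<close> of which only the entries \<open>z 1, \<dots>, z m\<close> are used.\<close>

definition bag :: "nat \<Rightarrow> (nat \<Rightarrow> 'a) \<Rightarrow> 'a multiset" where
  "bag m z = image_mset z (mset_set {1..m})"

definition completed_data :: "nat \<Rightarrow> (nat \<Rightarrow> 'x \<times> 'y) \<Rightarrow> 'x \<Rightarrow> 'y \<Rightarrow> nat \<Rightarrow> 'x \<times> 'y" where
  "completed_data n z x y = z(n + 1 := (x, y))"

definition conformity_score :: "('a \<Rightarrow> 'a multiset \<Rightarrow> real) \<Rightarrow> nat \<Rightarrow> (nat \<Rightarrow> 'a) \<Rightarrow> nat \<Rightarrow> real" where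
  "conformity_score s n z i = s (z i) (bag (n + 1) z)"

text \<open>The infimum is taken in the extended reals because the set of admissible thresholds is
  unbounded below when the total weight is at most \<open>\<alpha> * (n + 1)\<close>; the infimum is then
  \<open>- \<infinity>\<close>.\<close>

definition unnormalized_threshold ::
    "('a \<Rightarrow> 'a multiset \<Rightarrow> real) \<Rightarrow> ('a \<Rightarrow> real) \<Rightarrow> real \<Rightarrow> nat \<Rightarrow> (nat \<Rightarrow> 'a) \<Rightarrow> ereal" where
  "unnormalized_threshold s w \<alpha> n z =
    Inf (ereal ` {t :: real.
      (\<Sum>i = 1..n + 1. w (z i) * (if conformity_score s n z i > t then 1 else 0)) / real (n + 1) \<le> \<alpha>})"

definition unnormalized_prediction_set ::
    "'y measure \<Rightarrow> ('x \<times> 'y \<Rightarrow> ('x \<times> 'y) multiset \<Rightarrow> real) \<Rightarrow> ('x \<times> 'y \<Rightarrow> real) \<Rightarrow> real \<Rightarrow> nat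
      \<Rightarrow> (nat \<Rightarrow> 'x \<times> 'y) \<Rightarrow> 'x \<Rightarrow> 'y set" where
  "unnormalized_prediction_set MY s w \<alpha> n z x =
    {y \<in> space MY.
      ereal (conformity_score s n (completed_data n z x y) (n + 1))
        \<le> unnormalized_threshold s w \<alpha> n (completed_data n z x y)}"

end

theory Submission imports Defs begin

text \<open>
  Write \<open>q(z)\<close> for the threshold of a dataset \<open>z\<close>; its \<open>i\<close>th entry is called excluded if its score
  exceeds \<open>q(z)\<close>. Completing the data with the true \<open>Y\<^sub>n\<^sub>+\<^sub>1\<close> gives back the data, so miscoverage
  means that entry \<open>n + 1\<close> of \<open>Z\<close> is excluded. Three observations bound its probability.

  The excluded entries of any fixed dataset have total weight at most \<open>\<alpha> (n + 1)\<close>: this is what the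
  choice of the threshold enforces (\<open>excluded_weight_le\<close>).

  The score and the threshold use the dataset only through its bag, so permuting a dataset permutes
  its excluded entries. If all entries are drawn from \<open>F\<close>, every position therefore contributes the
  same expected excluded weight, and averaging over positions shows that the last one contributes
  at most \<open>\<alpha>\<close> (\<open>nn_integral_excluded_weight_le\<close>).

  The true law of the data has density \<open>w\<^sup>*(z\<^sub>n\<^sub>+\<^sub>1)\<close> with respect to \<open>F\<^sup>n\<^sup>+\<^sup>1\<close>
  (\<open>nn_integral_PiM_density_coordinate\<close>), so the miscoverage probability is the expectation under
  \<open>F\<^sup>n\<^sup>+\<^sup>1\<close> of the weight \<open>w\<^sup>*\<close> on the event that entry \<open>n + 1\<close> is excluded. Replacing \<open>w\<^sup>*\<close> by \<open>w\<close>
  costs at most \<open>E\<^sub>F[(w\<^sup>* - w)\<^sub>+]\<close>, which gives (b) (\<open>nn_integral_excluded_le\<close>); for \<open>w = w\<^sup>*\<close>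
  this cost vanishes, which gives (a).
\<close>

section \<open>The excluded scores\<close>

text \<open>The threshold lies strictly below \<open>c\<close> exactly when some admissible \<open>t\<close> does, and
  admissibility is inherited by larger \<open>t\<close>. As only finitely many scores occur, \<open>t\<close> can be taken in
  the gap just below \<open>c\<close>, where the condition on \<open>t\<close> becomes the one on the right. It involves
  no infimum, so that measurability can be read off it.\<close>

lemma unnormalized_threshold_less_iff:
  fixes w :: "'a \<Rightarrow> real"
  assumes nonneg: "\<And>j. j \<in> {1..n + 1} \<Longrightarrow> 0 \<le> w (z j)"
  shows "unnormalized_threshold s w \<alpha> n z < ereal c \<longleftrightarrow>
    (\<Sum>j = 1..n + 1. w (z j) * (if c \<le> conformity_score s n z j then 1 else 0)) \<le> \<alpha> * real (n + 1)"
    (is "?L \<longleftrightarrow> ?at c \<le> _")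
proof -
  define above where "above t =
    (\<Sum>j = 1..n + 1. w (z j) * (if conformity_score s n z j > t then 1 else 0))" for t
  have "?L \<longleftrightarrow> (\<exists>t<c. above t \<le> \<alpha> * real (n + 1))"
    unfolding unnormalized_threshold_def above_def
    by (auto simp: Inf_less_iff field_simps simp del: of_nat_Suc of_nat_add)
  also have "\<dots> \<longleftrightarrow> ?at c \<le> \<alpha> * real (n + 1)"
  proof
    assume "\<exists>t<c. above t \<le> \<alpha> * real (n + 1)"
    then obtain t where t: "t < c" "above t \<le> \<alpha> * real (n + 1)" by blast
    have "?at c \<le> above t"
      unfolding above_def using t(1) nonneg by (intro sum_mono mult_left_mono) auto
    then show "?at c \<le> \<alpha> * real (n + 1)" using t(2) by linarith
  next
    assume at: "?at c \<le> \<alpha> * real (n + 1)"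
    \<comment> \<open>The extra element \<open>c - 1\<close> covers the case that no score lies below \<open>c\<close>.\<close>
    define t where
      "t = Max (insert (c - 1) {v \<in> conformity_score s n z ` {1..n + 1}. v < c})"
    have fin: "finite {v \<in> conformity_score s n z ` {1..n + 1}. v < c}"
      by simp
    have "t < c" unfolding t_def using fin by (subst Max_less_iff) auto
    have below: "conformity_score s n z j \<le> t"
      if "j \<in> {1..n + 1}" "conformity_score s n z j < c" for j
      unfolding t_def using fin that by (intro Max_ge) auto
    have "above t = ?at c"
      unfolding above_def
    proof (intro sum.cong refl)
      fix j assume "j \<in> {1..n + 1}"
      then show "w (z j) * (if t < conformity_score s n z j then 1 else 0) =
          w (z j) * (if c \<le> conformity_score s n z j then 1 else 0)"
        using below[of j] \<open>t < c\<close> by fastforce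
    qed
    then show "\<exists>t<c. above t \<le> \<alpha> * real (n + 1)"
      using at \<open>t < c\<close> by auto
  qed
  finally show ?thesis .
qed

definition excluded ::
    "('a \<Rightarrow> 'a multiset \<Rightarrow> real) \<Rightarrow> ('a \<Rightarrow> real) \<Rightarrow> real \<Rightarrow> nat \<Rightarrow> (nat \<Rightarrow> 'a) \<Rightarrow> nat \<Rightarrow> bool" where
  "excluded s w \<alpha> n z i \<longleftrightarrow>
    unnormalized_threshold s w \<alpha> n z < ereal (conformity_score s n z i)"

text \<open>If \<open>m\<close> is the excluded index of smallest score, then every excluded score is at least that of
  \<open>m\<close>, and the weight of the scores at least that of \<open>m\<close> is bounded because \<open>m\<close> is excluded.\<close>

lemma excluded_weight_le:
  assumes nonneg: "\<And>j. j \<in> {1..n + 1} \<Longrightarrow> 0 \<le> w (z j)" and "0 \<le> \<alpha>"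
  shows "(\<Sum>i = 1..n + 1. w (z i) * (if excluded s w \<alpha> n z i then 1 else 0)) \<le> \<alpha> * real (n + 1)"
proof (cases "\<exists>i \<in> {1..n + 1}. excluded s w \<alpha> n z i")
  case False
  then have "(\<Sum>i = 1..n + 1. w (z i) * (if excluded s w \<alpha> n z i then 1 else 0)) = 0"
    by (intro sum.neutral) auto
  then show ?thesis using \<open>0 \<le> \<alpha>\<close> by simp
next
  case True
  let ?E = "{i \<in> {1..n + 1}. excluded s w \<alpha> n z i}"
  have "finite ?E" "?E \<noteq> {}" using True by auto
  then obtain m where m: "m \<in> ?E"
    "\<And>i. i \<in> ?E \<Longrightarrow> conformity_score s n z m \<le> conformity_score s n z i"
    by (metis (no_types, lifting) arg_min_if_finite(1) arg_min_least)
  have "(\<Sum>i = 1..n + 1. w (z i) * (if excluded s w \<alpha> n z i then 1 else 0)) \<le>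
      (\<Sum>i = 1..n + 1. w (z i) *
        (if conformity_score s n z m \<le> conformity_score s n z i then 1 else 0))"
    using nonneg m(2) by (intro sum_mono mult_left_mono) auto
  also have "\<dots> \<le> \<alpha> * real (n + 1)"
    using m(1) nonneg unfolding excluded_def
    by (subst unnormalized_threshold_less_iff[symmetric]) auto
  finally show ?thesis .
qed

section \<open>Symmetry of exclusion\<close>

text \<open>Datasets are total functions, but product measures only see them on \<open>{1..n + 1}\<close>; the
  extensional restriction is therefore built into the permuted dataset.\<close>

lemma conformity_score_permute:
  assumes "\<pi> permutes {1..n + 1}" "i \<in> {1..n + 1}"
  shows "conformity_score s n (\<lambda>j\<in>{1..n + 1}. z (\<pi> j)) i = conformity_score s n z (\<pi> i)"
proof -
  have "bag (n + 1) (\<lambda>j\<in>{1..n + 1}. z (\<pi> j)) = image_mset z (image_mset \<pi> (mset_set {1..n + 1}))"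
    unfolding bag_def multiset.map_comp by (intro image_mset_cong) auto
  also have "\<dots> = bag (n + 1) z"
    using permutes_image_mset[OF assms(1)] by (simp add: bag_def)
  finally show ?thesis
    using assms(2) by (simp add: conformity_score_def)
qed

lemma unnormalized_threshold_permute:
  assumes "\<pi> permutes {1..n + 1}"
  shows "unnormalized_threshold s w \<alpha> n (\<lambda>j\<in>{1..n + 1}. z (\<pi> j)) = unnormalized_threshold s w \<alpha> n z"
proof -
  have "(\<Sum>i = 1..n + 1. w ((\<lambda>j\<in>{1..n + 1}. z (\<pi> j)) i) *
        (if conformity_score s n (\<lambda>j\<in>{1..n + 1}. z (\<pi> j)) i > t then 1 else 0)) =
      (\<Sum>i = 1..n + 1. w (z i) * (if conformity_score s n z i > t then 1 else 0))" for t
  proof -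
    have "(\<Sum>i = 1..n + 1. w ((\<lambda>j\<in>{1..n + 1}. z (\<pi> j)) i) *
        (if conformity_score s n (\<lambda>j\<in>{1..n + 1}. z (\<pi> j)) i > t then 1 else 0)) =
      (\<Sum>i = 1..n + 1. w (z (\<pi> i)) * (if conformity_score s n z (\<pi> i) > t then 1 else 0))"
      by (intro sum.cong refl, subst conformity_score_permute[OF assms]) auto
    also have "\<dots> = (\<Sum>i = 1..n + 1. w (z i) * (if conformity_score s n z i > t then 1 else 0))"
      using sum.permute[OF assms, of "\<lambda>i. w (z i) * (if conformity_score s n z i > t then 1 else 0)"]
      by (simp add: o_def)
    finally show ?thesis .
  qed
  then show ?thesis unfolding unnormalized_threshold_def by simp
qed

lemma excluded_permute:
  assumes "\<pi> permutes {1..n + 1}" "i \<in> {1..n + 1}"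
  shows "excluded s w \<alpha> n (\<lambda>j\<in>{1..n + 1}. z (\<pi> j)) i \<longleftrightarrow> excluded s w \<alpha> n z (\<pi> i)"
  unfolding excluded_def conformity_score_permute[OF assms]
    unnormalized_threshold_permute[OF assms(1)] ..

lemma excluded_restrict:
  assumes "i \<in> {1..n + 1}"
  shows "excluded s w \<alpha> n (\<lambda>j\<in>{1..n + 1}. z j) i \<longleftrightarrow> excluded s w \<alpha> n z i"
  using excluded_permute[OF permutes_id assms, where z = z] by simp

section \<open>Measurability\<close>

lemma measurable_at_coordinate:
  assumes "f \<in> F \<rightarrow>\<^sub>M N" "i \<in> I"
  shows "(\<lambda>z. f (z i)) \<in> (\<Pi>\<^sub>M j\<in>I. F) \<rightarrow>\<^sub>M N"
  using measurable_compose[OF measurable_component_singleton[OF assms(2), of "\<lambda>_. F"] assms(1)] .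

lemma measurable_conformity_score:
  assumes s: "(\<lambda>(p, z). s p (bag (n + 1) z)) \<in> borel_measurable (F \<Otimes>\<^sub>M (\<Pi>\<^sub>M i\<in>{1..n + 1}. F))"
    and i: "i \<in> {1..n + 1}"
  shows "(\<lambda>z. conformity_score s n z i) \<in> borel_measurable (\<Pi>\<^sub>M i\<in>{1..n + 1}. F)"
proof -
  have "(\<lambda>z. (z i, z)) \<in> (\<Pi>\<^sub>M i\<in>{1..n + 1}. F) \<rightarrow>\<^sub>M F \<Otimes>\<^sub>M (\<Pi>\<^sub>M i\<in>{1..n + 1}. F)"
    using i by (intro measurable_Pair measurable_component_singleton measurable_ident) auto
  from measurable_compose[OF this s] show ?thesis
    by (simp add: conformity_score_def)
qed

lemma measurable_excluded:
  assumes s: "(\<lambda>(p, z). s p (bag (n + 1) z)) \<in> borel_measurable (F \<Otimes>\<^sub>M (\<Pi>\<^sub>M i\<in>{1..n + 1}. F))"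
    and w: "w \<in> borel_measurable F" "\<And>p. p \<in> space F \<Longrightarrow> 0 \<le> w p"
    and i: "i \<in> {1..n + 1}"
  shows "Measurable.pred (\<Pi>\<^sub>M i\<in>{1..n + 1}. F) (\<lambda>z. excluded s w \<alpha> n z i)"
proof -
  have [measurable]: "(\<lambda>z. conformity_score s n z j) \<in> borel_measurable (\<Pi>\<^sub>M i\<in>{1..n + 1}. F)"
    if "j \<in> {1..n + 1}" for j
    using measurable_conformity_score[OF s that] .
  have [measurable]: "(\<lambda>z. w (z j)) \<in> borel_measurable (\<Pi>\<^sub>M i\<in>{1..n + 1}. F)"
    if "j \<in> {1..n + 1}" for j
    using measurable_at_coordinate[OF w(1) that] .
  have "Measurable.pred (\<Pi>\<^sub>M i\<in>{1..n + 1}. F) (\<lambda>z. (\<Sum>j = 1..n + 1. w (z j) *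
      (if conformity_score s n z i \<le> conformity_score s n z j then 1 else 0)) \<le> \<alpha> * real (n + 1))"
    using i by measurable
  also have "?this \<longleftrightarrow> ?thesis"
  proof (rule measurable_cong)
    fix z assume z: "z \<in> space (\<Pi>\<^sub>M i\<in>{1..n + 1}. F)"
    then have "0 \<le> w (z j)" if "j \<in> {1..n + 1}" for j
      using w(2) that by (auto simp: space_PiM PiE_iff)
    then show "((\<Sum>j = 1..n + 1. w (z j) *
        (if conformity_score s n z i \<le> conformity_score s n z j then 1 else 0)) \<le> \<alpha> * real (n + 1))
        \<longleftrightarrow> excluded s w \<alpha> n z i"
      unfolding excluded_def by (subst unnormalized_threshold_less_iff) auto
  qed
  finally show ?thesis .
qed

section \<open>Product measures\<close>

lemma nn_integral_PiM_permute:
  assumes "prob_space F" and \<pi>: "\<pi> permutes I"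
    and f: "f \<in> borel_measurable (\<Pi>\<^sub>M i\<in>I. F)"
  shows "(\<integral>\<^sup>+z. f (\<lambda>i\<in>I. z (\<pi> i)) \<partial>(\<Pi>\<^sub>M i\<in>I. F)) = (\<integral>\<^sup>+z. f z \<partial>(\<Pi>\<^sub>M i\<in>I. F))"
proof -
  have in_I: "\<pi> i \<in> I" if "i \<in> I" for i using \<pi> that by (simp add: permutes_in_image)
  have meas: "(\<lambda>z. \<lambda>i\<in>I. z (\<pi> i)) \<in> (\<Pi>\<^sub>M i\<in>I. F) \<rightarrow>\<^sub>M (\<Pi>\<^sub>M i\<in>I. F)"
    using in_I by (intro measurable_restrict measurable_component_singleton)
  have "distr (\<Pi>\<^sub>M i\<in>I. F) (\<Pi>\<^sub>M i\<in>I. F) (\<lambda>z. \<lambda>i\<in>I. z (\<pi> i)) = (\<Pi>\<^sub>M i\<in>I. F)"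
    using distr_PiM_reindex[of I "\<lambda>_. F" \<pi> I] assms(1) permutes_inj_on[OF \<pi>] in_I by auto
  then show ?thesis
    using nn_integral_distr[OF meas] f by metis
qed

text \<open>Integrating out the coordinate \<open>i\<close> first reduces this to the density of \<open>G\<close> with respect to
  \<open>F\<close>.\<close>

lemma nn_integral_PiM_density_coordinate:
  fixes g :: "'a \<Rightarrow> ennreal"
  assumes "prob_space F" "prob_space G" and G: "G = density F g"
    and g: "g \<in> borel_measurable F"
    and I: "finite I" "i \<notin> I"
    and f: "f \<in> borel_measurable (\<Pi>\<^sub>M j\<in>insert i I. F)"
  shows "(\<integral>\<^sup>+z. f z \<partial>(\<Pi>\<^sub>M j\<in>insert i I. if j = i then G else F)) =
    (\<integral>\<^sup>+z. g (z i) * f z \<partial>(\<Pi>\<^sub>M j\<in>insert i I. F))"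
proof -
  have sf: "sigma_finite_measure F" "sigma_finite_measure G"
    using assms(1,2) by (auto intro: prob_space_imp_sigma_finite)
  interpret FF: product_sigma_finite "\<lambda>_. F"
    using sf by (simp add: product_sigma_finite_def)
  interpret FG: product_sigma_finite "\<lambda>j. if j = i then G else F"
    using sf by (auto simp: product_sigma_finite_def)
  have sets: "sets (\<Pi>\<^sub>M j\<in>insert i I. if j = i then G else F) = sets (\<Pi>\<^sub>M j\<in>insert i I. F)"
    by (intro sets_PiM_cong) (auto simp: G)
  have rest: "(\<Pi>\<^sub>M j\<in>I. if j = i then G else F) = (\<Pi>\<^sub>M j\<in>I. F)"
    using I by (intro PiM_cong) auto
  have [measurable]: "(\<lambda>z. g (z i)) \<in> borel_measurable (\<Pi>\<^sub>M j\<in>insert i I. F)"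
    using g by (rule measurable_at_coordinate) simp
  have "(\<integral>\<^sup>+z. f z \<partial>(\<Pi>\<^sub>M j\<in>insert i I. if j = i then G else F)) =
      (\<integral>\<^sup>+x. \<integral>\<^sup>+y. f (x(i := y)) \<partial>G \<partial>(\<Pi>\<^sub>M j\<in>I. F))"
    using f by (subst FG.product_nn_integral_insert[OF I])
      (simp_all add: rest measurable_cong_sets[OF sets])
  also have "\<dots> = (\<integral>\<^sup>+x. \<integral>\<^sup>+y. g y * f (x(i := y)) \<partial>F \<partial>(\<Pi>\<^sub>M j\<in>I. F))"
  proof (rule nn_integral_cong)
    fix x assume x: "x \<in> space (\<Pi>\<^sub>M j\<in>I. F)"
    have "(\<lambda>y. x(i := y)) \<in> F \<rightarrow>\<^sub>M (\<Pi>\<^sub>M j\<in>insert i I. F)"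
      using x by (intro measurable_fun_upd[where J = I]) auto
    from measurable_compose[OF this f]
    show "(\<integral>\<^sup>+y. f (x(i := y)) \<partial>G) = (\<integral>\<^sup>+y. g y * f (x(i := y)) \<partial>F)"
      unfolding G using g by (intro nn_integral_density)
  qed
  also have "\<dots> = (\<integral>\<^sup>+z. g (z i) * f z \<partial>(\<Pi>\<^sub>M j\<in>insert i I. F))"
    using f by (subst FF.product_nn_integral_insert[OF I]) simp_all
  finally show ?thesis .
qed

section \<open>Miscoverage\<close>

text \<open>Under the exchangeable law \<open>F\<^sup>n\<^sup>+\<^sup>1\<close> the position of a point carries no information, so the
  expected excluded weight at position \<open>n + 1\<close> is the average over all positions, which the
  deterministic bound controls pointwise.\<close>

lemma nn_integral_excluded_weight_le:
  fixes w :: "'a \<Rightarrow> real"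
  assumes "prob_space F" "0 \<le> \<alpha>"
    and s: "(\<lambda>(p, z). s p (bag (n + 1) z)) \<in> borel_measurable (F \<Otimes>\<^sub>M (\<Pi>\<^sub>M i\<in>{1..n + 1}. F))"
    and w: "w \<in> borel_measurable F" "\<And>p. p \<in> space F \<Longrightarrow> 0 \<le> w p"
  shows "(\<integral>\<^sup>+z. ennreal (w (z (n + 1))) * (if excluded s w \<alpha> n z (n + 1) then 1 else 0)
    \<partial>(\<Pi>\<^sub>M i\<in>{1..n + 1}. F)) \<le> ennreal \<alpha>"
proof -
  let ?P = "\<Pi>\<^sub>M i\<in>{1..n + 1}. F"
  let ?h = "\<lambda>i z. ennreal (w (z i)) * (if excluded s w \<alpha> n z i then 1 else 0)"
  interpret P: prob_space ?P
    using assms(1) by (intro prob_space_PiM)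
  have meas: "?h i \<in> borel_measurable ?P" if i: "i \<in> {1..n + 1}" for i
  proof -
    have [measurable]: "(\<lambda>z. w (z i)) \<in> borel_measurable ?P"
      using measurable_at_coordinate[OF w(1) i] .
    note [measurable] = measurable_excluded[OF s w i, of \<alpha>]
    show ?thesis by measurable
  qed
  have same: "(\<integral>\<^sup>+z. ?h i z \<partial>?P) = (\<integral>\<^sup>+z. ?h (n + 1) z \<partial>?P)" if i: "i \<in> {1..n + 1}" for i
  proof -
    let ?\<pi> = "Transposition.transpose i (n + 1)"
    have \<pi>: "?\<pi> permutes {1..n + 1}"
      using i by (intro permutes_swap_id) auto
    have "(\<integral>\<^sup>+z. ?h (n + 1) z \<partial>?P) = (\<integral>\<^sup>+z. ?h (n + 1) (\<lambda>j\<in>{1..n + 1}. z (?\<pi> j)) \<partial>?P)"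
      using meas[of "n + 1"] by (intro nn_integral_PiM_permute[OF assms(1) \<pi>, symmetric]) auto
    also have "\<dots> = (\<integral>\<^sup>+z. ?h i z \<partial>?P)"
      by (subst excluded_permute[OF \<pi>]) auto
    finally show ?thesis by simp
  qed
  have "of_nat (n + 1) * (\<integral>\<^sup>+z. ?h (n + 1) z \<partial>?P) = (\<Sum>i = 1..n + 1. \<integral>\<^sup>+z. ?h i z \<partial>?P)"
    by (subst sum.cong[OF refl same]) auto
  also have "\<dots> = (\<integral>\<^sup>+z. (\<Sum>i = 1..n + 1. ?h i z) \<partial>?P)"
    using meas by (intro nn_integral_sum[symmetric])
  also have "\<dots> \<le> (\<integral>\<^sup>+z. ennreal (\<alpha> * real (n + 1)) \<partial>?P)"
  proof (rule nn_integral_mono)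
    fix z assume "z \<in> space ?P"
    then have nonneg: "0 \<le> w (z j)" if "j \<in> {1..n + 1}" for j
      using w(2) that by (auto simp: space_PiM PiE_iff)
    have "(\<Sum>i = 1..n + 1. ?h i z) =
        (\<Sum>i = 1..n + 1. ennreal (w (z i) * (if excluded s w \<alpha> n z i then 1 else 0)))"
      by (intro sum.cong) auto
    also have "\<dots> = ennreal (\<Sum>i = 1..n + 1. w (z i) * (if excluded s w \<alpha> n z i then 1 else 0))"
      using nonneg by (intro sum_ennreal) auto
    also have "\<dots> \<le> ennreal (\<alpha> * real (n + 1))"
      using nonneg \<open>0 \<le> \<alpha>\<close> by (intro ennreal_leI excluded_weight_le)
    finally show "(\<Sum>i = 1..n + 1. ?h i z) \<le> ennreal (\<alpha> * real (n + 1))" .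
  qed
  also have "\<dots> = of_nat (n + 1) * ennreal \<alpha>"
    using \<open>0 \<le> \<alpha>\<close> P.emeasure_space_1
    by (simp add: ennreal_mult ennreal_of_nat_eq_real_of_nat mult.commute del: of_nat_Suc of_nat_add)
  finally show ?thesis
    by (subst (asm) ennreal_mult_le_mult_iff) auto
qed

text \<open>Everywhere \<open>w\<^sup>* \<le> w + (w\<^sup>* - w)\<^sub>+\<close>. On the event that entry \<open>n + 1\<close> is excluded, the first
  summand contributes at most \<open>\<alpha>\<close>; the second contributes at most its expectation over the whole
  space, an integral against \<open>F\<close> alone because it depends on one coordinate only.\<close>

lemma nn_integral_excluded_le:
  fixes w wstar :: "'a \<Rightarrow> real"
  assumes "prob_space F" "prob_space G" and G: "G = density F (\<lambda>p. ennreal (wstar p))"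
    and wstar: "wstar \<in> borel_measurable F"
    and "0 \<le> \<alpha>"
    and s: "(\<lambda>(p, z). s p (bag (n + 1) z)) \<in> borel_measurable (F \<Otimes>\<^sub>M (\<Pi>\<^sub>M i\<in>{1..n + 1}. F))"
    and w: "w \<in> borel_measurable F" "\<And>p. p \<in> space F \<Longrightarrow> 0 \<le> w p"
  shows "emeasure (\<Pi>\<^sub>M i\<in>{1..n + 1}. if i = n + 1 then G else F)
      {z \<in> space (\<Pi>\<^sub>M i\<in>{1..n + 1}. F). excluded s w \<alpha> n z (n + 1)}
    \<le> ennreal \<alpha> + (\<integral>\<^sup>+p. ennreal (max (wstar p - w p) 0) \<partial>F)"
proof -
  let ?P = "\<Pi>\<^sub>M i\<in>{1..n + 1}. F" and ?Q = "\<Pi>\<^sub>M i\<in>{1..n + 1}. if i = n + 1 then G else F"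
  let ?E = "{z \<in> space ?P. excluded s w \<alpha> n z (n + 1)}"
  let ?d = "\<lambda>p. max (wstar p - w p) 0"
  have I: "{1..n + 1} = insert (n + 1) {1..n}" by auto
  have last: "n + 1 \<in> {1..n + 1}" by simp
  have E: "?E \<in> sets ?P"
    using measurable_excluded[OF s w last] by (rule predE)
  have sets: "sets ?Q = sets ?P"
    by (intro sets_PiM_cong) (auto simp: G)
  have d: "?d \<in> borel_measurable F"
    using wstar w(1) by measurable
  note [measurable] = measurable_excluded[OF s w last, of \<alpha>]
    measurable_at_coordinate[OF w(1) last] measurable_at_coordinate[OF d last]
  have density: "(\<integral>\<^sup>+z. f z \<partial>?Q) = (\<integral>\<^sup>+z. ennreal (wstar (z (n + 1))) * f z \<partial>?P)"
    if "f \<in> borel_measurable ?P" for f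
  proof (rule nn_integral_PiM_density_coordinate[OF assms(1,2) G, of "{1..n}" "n + 1", folded I])
    show "(\<lambda>p. ennreal (wstar p)) \<in> borel_measurable F"
      using wstar by measurable
  qed (use that in auto)
  have "emeasure ?Q ?E = (\<integral>\<^sup>+z. indicator ?E z \<partial>?Q)"
    by (rule nn_integral_indicator[symmetric]) (simp only: sets E)
  also have "\<dots> = (\<integral>\<^sup>+z. ennreal (wstar (z (n + 1))) * indicator ?E z \<partial>?P)"
    using E by (intro density borel_measurable_indicator)
  also have "\<dots> \<le> (\<integral>\<^sup>+z. ennreal (w (z (n + 1))) * (if excluded s w \<alpha> n z (n + 1) then 1 else 0)
      + ennreal (?d (z (n + 1))) \<partial>?P)"
  proof (rule nn_integral_mono)
    fix z assume "z \<in> space ?P"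
    then have "0 \<le> w (z (n + 1))"
      using w(2) last by (auto simp: space_PiM PiE_iff)
    then have split: "ennreal (w (z (n + 1))) + ennreal (?d (z (n + 1)))
        = ennreal (w (z (n + 1)) + ?d (z (n + 1)))"
      by (intro ennreal_plus[symmetric]) auto
    have "ennreal (wstar (z (n + 1))) \<le> ennreal (w (z (n + 1))) + ennreal (?d (z (n + 1)))"
      unfolding split by (intro ennreal_leI) linarith
    then show "ennreal (wstar (z (n + 1))) * indicator ?E z \<le>
        ennreal (w (z (n + 1))) * (if excluded s w \<alpha> n z (n + 1) then 1 else 0)
        + ennreal (?d (z (n + 1)))"
      by (auto simp: indicator_def)
  qed
  also have "\<dots> = (\<integral>\<^sup>+z. ennreal (w (z (n + 1))) * (if excluded s w \<alpha> n z (n + 1) then 1 else 0) \<partial>?P)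
      + (\<integral>\<^sup>+z. ennreal (?d (z (n + 1))) \<partial>?P)"
    by (intro nn_integral_add) measurable
  also have "(\<integral>\<^sup>+z. ennreal (?d (z (n + 1))) \<partial>?P) = (\<integral>\<^sup>+p. ennreal (?d p) \<partial>distr ?P F (\<lambda>z. z (n + 1)))"
    using measurable_compose[OF d measurable_ennreal] measurable_component_singleton[OF last]
    by (intro nn_integral_distr[symmetric]) simp_all
  also have "distr ?P F (\<lambda>z. z (n + 1)) = F"
    using assms(1) last by (intro distr_PiM_component) auto
  also have "(\<integral>\<^sup>+z. ennreal (w (z (n + 1))) * (if excluded s w \<alpha> n z (n + 1) then 1 else 0) \<partial>?P)
      \<le> ennreal \<alpha>"
    by (rule nn_integral_excluded_weight_le) fact+
  finally show ?thesis by (simp add: add_right_mono)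
qed

theorem theorem11:
  fixes MX :: "'x measure" and MY :: "'y measure"
    and F G :: "('x \<times> 'y) measure"
    and M :: "'w measure" and Z :: "nat \<Rightarrow> 'w \<Rightarrow> 'x \<times> 'y"
    and s :: "'x \<times> 'y \<Rightarrow> ('x \<times> 'y) multiset \<Rightarrow> real"
    and w wstar :: "'x \<times> 'y \<Rightarrow> real"
    and \<alpha> :: real and n :: nat
  assumes "n \<ge> 1"
    and "0 \<le> \<alpha>" and "\<alpha> \<le> 1"
    and "prob_space F" and "sets F = sets (MX \<Otimes>\<^sub>M MY)"
    and "prob_space G" and "sets G = sets (MX \<Otimes>\<^sub>M MY)"
    and "wstar \<in> borel_measurable (MX \<Otimes>\<^sub>M MY)"
    and "\<forall>p \<in> space (MX \<Otimes>\<^sub>M MY). 0 \<le> wstar p"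
    and "G = density F (\<lambda>p. ennreal (wstar p))"
    and "w \<in> borel_measurable (MX \<Otimes>\<^sub>M MY)"
    and "\<forall>p \<in> space (MX \<Otimes>\<^sub>M MY). 0 < w p"
    and "(\<lambda>(p, z). s p (bag (n + 1) z))
           \<in> borel_measurable ((MX \<Otimes>\<^sub>M MY) \<Otimes>\<^sub>M (\<Pi>\<^sub>M i\<in>{1..n + 1}. MX \<Otimes>\<^sub>M MY))"
    and "prob_space M"
    and "prob_space.indep_vars M (\<lambda>_. MX \<Otimes>\<^sub>M MY) Z {1..n + 1}"
    and "\<forall>i \<in> {1..n}. distr M (MX \<Otimes>\<^sub>M MY) (Z i) = F"
    and "distr M (MX \<Otimes>\<^sub>M MY) (Z (n + 1)) = G"
  defines "coverage \<equiv> measure M {\<omega> \<in> space M.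
      snd (Z (n + 1) \<omega>)
        \<in> unnormalized_prediction_set MY s w \<alpha> n (\<lambda>i. Z i \<omega>) (fst (Z (n + 1) \<omega>))}"
  shows "((AE p in F. w p = wstar p) \<longrightarrow> coverage \<ge> 1 - \<alpha>) \<and>
         coverage \<ge> 1 - \<alpha> - (\<integral>p. max (wstar p - w p) 0 \<partial>F)"
proof -
  interpret M: prob_space M by fact
  let ?N = "MX \<Otimes>\<^sub>M MY" and ?I = "{1..n + 1}"
  let ?PF = "\<Pi>\<^sub>M i\<in>?I. F" and ?PN = "\<Pi>\<^sub>M i\<in>?I. ?N" and ?Q = "\<Pi>\<^sub>M i\<in>?I. if i = n + 1 then G else F"
  let ?Z = "\<lambda>\<omega>. \<lambda>i\<in>?I. Z i \<omega>"
  let ?d = "\<lambda>p. max (wstar p - w p) 0"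
  let ?E = "{z \<in> space ?PF. excluded s w \<alpha> n z (n + 1)}"
  note F = \<open>prob_space F\<close> and G = \<open>prob_space G\<close>
  have setsF: "sets F = sets ?N" by fact
  have spaceF: "space F = space ?N" using setsF by (rule sets_eq_imp_space_eq)
  have setsP: "sets ?PF = sets ?PN" using setsF by (intro sets_PiM_cong) auto
  have spaceP: "space ?PF = space ?PN" using setsP by (rule sets_eq_imp_space_eq)
  have w: "w \<in> borel_measurable F" "\<And>p. p \<in> space F \<Longrightarrow> 0 \<le> w p"
    using \<open>w \<in> borel_measurable ?N\<close> \<open>\<forall>p \<in> space ?N. 0 < w p\<close>
    by (auto simp: measurable_cong_sets[OF setsF] spaceF less_imp_le)
  have wstar: "wstar \<in> borel_measurable F" "\<And>p. p \<in> space F \<Longrightarrow> 0 \<le> wstar p"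
    using \<open>wstar \<in> borel_measurable ?N\<close> \<open>\<forall>p \<in> space ?N. 0 \<le> wstar p\<close>
    by (auto simp: measurable_cong_sets[OF setsF] spaceF)
  have s: "(\<lambda>(p, z). s p (bag (n + 1) z)) \<in> borel_measurable (F \<Otimes>\<^sub>M ?PF)"
    using assms(13) by (simp only: measurable_cong_sets[OF sets_pair_measure_cong[OF setsF setsP] refl])
  have rv: "Z i \<in> M \<rightarrow>\<^sub>M ?N" if "i \<in> ?I" for i
    using \<open>M.indep_vars (\<lambda>_. ?N) Z ?I\<close> that by (auto simp: M.indep_vars_def)
  have Zmeas: "?Z \<in> M \<rightarrow>\<^sub>M ?PN"
    using rv by (intro measurable_restrict)
  have law: "distr M ?PN ?Z = ?Q"
  proof -
    have "distr M ?PN ?Z = (\<Pi>\<^sub>M i\<in>?I. distr M ?N (Z i))"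
      using M.indep_vars_iff_distr_eq_PiM'[of ?I Z "\<lambda>_. ?N"] rv \<open>M.indep_vars (\<lambda>_. ?N) Z ?I\<close> by simp
    also have "\<dots> = ?Q"
      using assms(16,17) by (intro PiM_cong) auto
    finally show ?thesis .
  qed
  have E: "?E \<in> sets ?PN"
    unfolding setsP[symmetric] by (intro predE measurable_excluded[OF s w]) auto
  \<comment> \<open>A non-measurable event would get measure \<open>0\<close>, so the lower bound on the coverage rests on the
    measurability of \<open>?A\<close>.\<close>
  let ?A = "?Z -` ?E \<inter> space M"
  have A: "?A \<in> sets M" using measurable_sets[OF Zmeas E] .
  have "{\<omega> \<in> space M. snd (Z (n + 1) \<omega>)
      \<in> unnormalized_prediction_set MY s w \<alpha> n (\<lambda>i. Z i \<omega>) (fst (Z (n + 1) \<omega>))} = space M - ?A"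
  proof -
    have "(snd (Z (n + 1) \<omega>)
        \<in> unnormalized_prediction_set MY s w \<alpha> n (\<lambda>i. Z i \<omega>) (fst (Z (n + 1) \<omega>)))
      \<longleftrightarrow> \<omega> \<notin> ?A" if \<omega>: "\<omega> \<in> space M" for \<omega>
    proof -
      have 1: "completed_data n (\<lambda>i. Z i \<omega>) (fst (Z (n + 1) \<omega>)) (snd (Z (n + 1) \<omega>)) = (\<lambda>i. Z i \<omega>)"
        by (auto simp: completed_data_def)
      have 2: "snd (Z (n + 1) \<omega>) \<in> space MY"
        using measurable_space[OF rv \<omega>, of "n + 1"] by (auto simp: space_pair_measure)
      have 3: "\<omega> \<in> ?A \<longleftrightarrow> excluded s w \<alpha> n (\<lambda>i. Z i \<omega>) (n + 1)"
      proof -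
        have "?Z \<omega> \<in> space ?PF"
          using measurable_space[OF Zmeas \<omega>] unfolding spaceP .
        moreover have "excluded s w \<alpha> n (?Z \<omega>) (n + 1) \<longleftrightarrow> excluded s w \<alpha> n (\<lambda>i. Z i \<omega>) (n + 1)"
          by (rule excluded_restrict) simp
        ultimately show ?thesis using \<omega> by simp
      qed
      have 4: "snd (Z (n + 1) \<omega>)
          \<in> unnormalized_prediction_set MY s w \<alpha> n (\<lambda>i. Z i \<omega>) (fst (Z (n + 1) \<omega>))
        \<longleftrightarrow> \<not> excluded s w \<alpha> n (\<lambda>i. Z i \<omega>) (n + 1)"
        unfolding unnormalized_prediction_set_def mem_Collect_eq 1 excluded_def
        using 2 by (simp add: not_less)
      show ?thesis unfolding 3 4 ..
    qed
    then show ?thesis by blast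
  qed
  then have cov: "coverage = 1 - measure M ?A"
    using M.prob_compl[OF A] by (simp add: coverage_def)
  \<comment> \<open>Since \<open>w > 0\<close>, \<open>(w\<^sup>* - w)\<^sub>+\<close> is dominated by \<open>w\<^sup>*\<close>, whose integral is \<open>1\<close>. A Bochner integral
    is \<open>0\<close> by convention where it does not exist, so this is needed to identify it with the
    nonnegative extended integral.\<close>
  have int: "integrable F ?d"
  proof (rule Bochner_Integration.integrable_bound)
    have "(\<integral>\<^sup>+p. ennreal (wstar p) \<partial>F) = (\<integral>\<^sup>+p. 1 \<partial>G)"
      unfolding \<open>G = density F (\<lambda>p. ennreal (wstar p))\<close>
      using wstar(1) by (subst nn_integral_density) simp_all
    then have "(\<integral>\<^sup>+p. ennreal (wstar p) \<partial>F) = 1"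
      using prob_space.emeasure_space_1[OF G] by simp
    then show "integrable F wstar"
      using wstar by (intro integrableI_nonneg) (auto intro: AE_I2)
    show "?d \<in> borel_measurable F" using w(1) wstar(1) by measurable
    show "AE p in F. norm (?d p) \<le> norm (wstar p)"
      using w(2) wstar(2) by (intro AE_I2) fastforce
  qed
  have d_nonneg: "0 \<le> (\<integral>p. ?d p \<partial>F)" by (rule Bochner_Integration.integral_nonneg) simp
  have "ennreal (measure M ?A) = emeasure (distr M ?PN ?Z) ?E"
    using emeasure_distr[OF Zmeas E] by (simp add: M.emeasure_eq_measure)
  also have "\<dots> \<le> ennreal \<alpha> + (\<integral>\<^sup>+p. ennreal (?d p) \<partial>F)"
    unfolding law
    by (rule nn_integral_excluded_le[OF F G _ wstar(1) _ s w]) fact+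
  also have "\<dots> = ennreal (\<alpha> + (\<integral>p. ?d p \<partial>F))"
    using \<open>0 \<le> \<alpha>\<close> d_nonneg by (subst nn_integral_eq_integral[OF int]) auto
  finally have bound: "measure M ?A \<le> \<alpha> + (\<integral>p. ?d p \<partial>F)"
    using \<open>0 \<le> \<alpha>\<close> d_nonneg by (subst (asm) ennreal_le_iff) auto
  have "(\<integral>p. ?d p \<partial>F) = 0" if "AE p in F. w p = wstar p"
    using that by (intro integral_eq_zero_AE) auto
  then show ?thesis using bound cov by auto
qed

end
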